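(* Let $A$ be an integral domain with field of fractions $Q(A)$, let $p\in Q(A)$ be a plant and $\Theta\in Q(A)$ a signal generator. Let $c$ be a robustly regulating controller for $p$ with signal generator $\Theta$. If $\Theta=\frac{\gamma}{\theta}$ is a weakly coprime factorization, then all robustly regulating controllers for $p$ with signal generator $\Theta$ are given by $$c(q_1,q_2)=\frac{b+q_1\,a^2+q_2\,b^2}{\theta\,a+q_1\,a^2\,p+q_2\,b^2\,p},$$ where $a:=(1-p\,c)^{-1}$, $b:=\theta\,c\,(1-p\,c)^{-1}$, and $q_1,q_2\in A$ are arbitrary elements such that $\theta\,a+q_1\,a^2\,p+q_2\,b^2\,p\neq 0$.
   Context: An integral domain is a commutative ring with unit $1$ and without zero divisors. A controller $c\in Q(A)$ stabilizes $p\in Q(A)$ if $1-pc\neq 0$ and $\frac{1}{1-pc},\ \frac{p}{1-pc},\ \frac{c}{1-pc}$ all belong to $A$. $\mathrm{Stab}(p)$ denotes the set of all stabilizing controllers of $p$. A controller $c$ is robustly regulating (for $p$, with signal generator $\Theta$) if $c\in\mathrm{Stab}(p)$ and for every $p'\in\mathrm{Stab}(c)$ one has $\Theta\,\frac{1}{1-p'c}\in A$ and $\Theta\,\frac{p'}{1-p'c}\in A$. A fractional representation $\Theta=\frac{\gamma}{\theta}$ (with $0\neq\theta\in A$, $\gamma\in A$) is a weakly coprime factorization if for all $k\in Q(A)$: $k\gamma\in A$ and $k\theta\in A$ imply $k\in A$. "All robustly regulating controllers are given by" means that the set of robustly regulating controllers for $p$ equals the set of all $c(q_1,q_2)$ with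 admissible $q_1,q_2$. *)

theory Defs
  imports "HOL-Computational_Algebra.Polynomial_Factorial"
begin

text \<open>
  The integral domain \<open>A\<close> is the type \<open>'a :: idom\<close>, its field of fractions \<open>Q(A)\<close> is
  \<open>'a fract\<close>, and \<open>A\<close> sits in \<open>Q(A)\<close> as \<open>range to_fract\<close>.
\<close>

definition stab :: "'a::idom fract \<Rightarrow> 'a fract set" where
  "stab p = {c. 1 - p * c \<noteq> 0 \<and>
     1 / (1 - p * c) \<in> range to_fract \<and>
     p / (1 - p * c) \<in> range to_fract \<and>
     c / (1 - p * c) \<in> range to_fract}"

text \<open>
  In the robustness condition \<open>c\<close> plays the role of the plant: \<open>p'\<close> runs through all
  plants that are stabilized by \<open>c\<close>.
\<close>

definition robustly_regulating ::
    "'a::idom fract \<Rightarrow> 'a fract \<Rightarrow> 'a fract \<Rightarrow> bool" where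
  "robustly_regulating p \<Theta> c \<longleftrightarrow> c \<in> stab p \<and>
     (\<forall>p' \<in> stab c. \<Theta> * (1 / (1 - p' * c)) \<in> range to_fract \<and>
                    \<Theta> * (p' / (1 - p' * c)) \<in> range to_fract)"

definition weakly_coprime_factorization ::
    "'a::idom fract \<Rightarrow> 'a \<Rightarrow> 'a \<Rightarrow> bool" where
  "weakly_coprime_factorization \<Theta> \<gamma> \<theta> \<longleftrightarrow>
     \<theta> \<noteq> 0 \<and> \<Theta> = to_fract \<gamma> / to_fract \<theta> \<and>
     (\<forall>k. k * to_fract \<gamma> \<in> range to_fract \<and> k * to_fract \<theta> \<in> range to_fract
            \<longrightarrow> k \<in> range to_fract)"

end

theory Submission
  imports Defs
begin

text \<open>
  Write \<open>A\<close> for \<open>range to_fract\<close>. For a stabilizing controller \<open>c\<close> of \<open>p\<close> put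
  \<open>x = 1 / (1 - p c)\<close> and \<open>v = c x\<close>, so that \<open>x - p v = 1\<close> and \<open>c = v / x\<close>. Once one
  stabilizing controller is known, every other one is obtained by replacing \<open>v\<close> with
  \<open>v + m\<close> and hence \<open>x\<close> with \<open>x + p m\<close>; what has to be determined is the set of
  admissible \<open>m\<close>.

  This is done by cubing the relation \<open>x - p v = 1\<close> and multiplying it by \<open>m\<close>: each
  term of the expansion contains \<open>x\<^sup>2\<close> or \<open>v\<^sup>2\<close>, and so \<open>m\<close> becomes a combination of
  \<open>x\<^sup>2\<close> and \<open>v\<^sup>2\<close> whose coefficients are combinations of \<open>m\<close>, \<open>p m\<close> and \<open>p\<^sup>2 m\<close>,
  with factors built from \<open>x\<close>, \<open>v\<close> and \<open>p v\<close>, which lie in \<open>A\<close>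
  (\<open>cubed_bezout_expansion\<close>). The expansion serves twice.

  With the roles of plant and controller exchanged, it shows that regulation at the nominal
  plant already implies regulation at every plant stabilized by \<open>c\<close>, so that \<open>c\<close> is
  robustly regulating iff it stabilizes \<open>p\<close> and \<open>\<Theta> x\<close>, \<open>\<Theta> p x\<close> lie in \<open>A\<close>
  (\<open>robustly_regulating_iff_nominal\<close>). For a weakly coprime factorization
  \<open>\<Theta> = \<gamma> / \<theta>\<close> this says that \<open>x / \<theta>\<close>, \<open>p x / \<theta>\<close> and \<open>v\<close> lie in \<open>A\<close>
  (\<open>robustly_regulating_iff_divisible\<close>). Hence the admissible \<open>m\<close> are those with
  \<open>x + p m \<noteq> 0\<close> for which
  \<open>m\<close>, \<open>p m / \<theta>\<close> and \<open>p\<^sup>2 m / \<theta>\<close> lie in \<open>A\<close>; by the expansion,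
  these three memberships mean that \<open>\<theta> m\<close> lies in the ideal generated by \<open>a\<^sup>2\<close> and
  \<open>b\<^sup>2\<close>, where \<open>a = x\<close> and \<open>b = \<theta> v\<close>.
\<close>

lemma range_to_fract_add:
  "x \<in> range to_fract \<Longrightarrow> y \<in> range to_fract \<Longrightarrow> x + y \<in> range to_fract"
  by (auto simp flip: to_fract_add)

lemma range_to_fract_diff:
  "x \<in> range to_fract \<Longrightarrow> y \<in> range to_fract \<Longrightarrow> x - y \<in> range to_fract"
  by (auto simp flip: to_fract_diff)

lemma range_to_fract_mult:
  "x \<in> range to_fract \<Longrightarrow> y \<in> range to_fract \<Longrightarrow> x * y \<in> range to_fract"
  by (auto simp flip: to_fract_mult)

lemma range_to_fract_one: "1 \<in> range to_fract"
  by (auto simp flip: to_fract_1)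

lemma range_to_fract_numeral: "numeral n \<in> range to_fract"
  by (induction n)
    (simp_all only: numeral_One numeral_Bit0 numeral_Bit1 range_to_fract_one range_to_fract_add)

lemmas range_to_fract_closed =
  rangeI[where f = to_fract] range_to_fract_one range_to_fract_numeral
  range_to_fract_add range_to_fract_diff range_to_fract_mult

lemma cubed_bezout_expansion:
  fixes x y z n :: "'a::comm_ring_1"
  assumes "x - z * y = 1"
  shows "n = x\<^sup>2 * (n * x - 3 * (n * z) * y) + y\<^sup>2 * (n * z\<^sup>2 * (3 * x - z * y))"
proof -
  have "n = n * (x - z * y) ^ 3"
    using assms by simp
  also have "\<dots> = x\<^sup>2 * (n * x - 3 * (n * z) * y) + y\<^sup>2 * (n * z\<^sup>2 * (3 * x - z * y))"
    by (simp add: power2_eq_square power3_eq_cube algebra_simps)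
  finally show ?thesis .
qed

lemma stab_sym: "c \<in> stab p \<longleftrightarrow> p \<in> stab c"
  by (auto simp: stab_def mult.commute)

text \<open>
  Since \<open>p \<in> stab c\<close>, the right-hand side is the case \<open>p' = p\<close> of the robustness condition.
  It suffices, because with \<open>x = 1 / (1 - p c)\<close> and \<open>w = p x\<close> any other \<open>p' \<in> stab c\<close>
  changes \<open>w\<close> by an element \<open>n\<close> of the ideal generated by \<open>x\<^sup>2\<close> and \<open>w\<^sup>2\<close>, and
  \<open>\<Theta>\<close> times \<open>n\<close> or \<open>n c\<close> is then a combination of \<open>\<Theta> x\<close> and \<open>\<Theta> w\<close>.
\<close>
lemma robustly_regulating_iff_nominal:
  "robustly_regulating p \<Theta> c \<longleftrightarrow>
     c \<in> stab p \<and> \<Theta> * (1 / (1 - p * c)) \<in> range to_fract \<and>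
     \<Theta> * (p / (1 - p * c)) \<in> range to_fract"
proof (intro iffI)
  assume "robustly_regulating p \<Theta> c"
  then show "c \<in> stab p \<and> \<Theta> * (1 / (1 - p * c)) \<in> range to_fract \<and>
      \<Theta> * (p / (1 - p * c)) \<in> range to_fract"
    by (auto simp: robustly_regulating_def stab_sym[of c p])
next
  assume nominal: "c \<in> stab p \<and> \<Theta> * (1 / (1 - p * c)) \<in> range to_fract \<and>
      \<Theta> * (p / (1 - p * c)) \<in> range to_fract"
  define x w where "x = 1 / (1 - p * c)" and "w = p / (1 - p * c)"
  have nz: "1 - p * c \<noteq> 0"
    using nominal by (simp add: stab_def)
  have bezout: "x - c * w = 1"
    using nz by (simp add: x_def w_def field_simps)
  have A: "x \<in> range to_fract" "w \<in> range to_fract" "c * x \<in> range to_fract"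
    using nominal by (simp_all add: stab_def x_def w_def)
  have cw: "c * w \<in> range to_fract"
    using range_to_fract_diff[OF A(1) range_to_fract_one] bezout by (simp add: algebra_simps)
  have \<Theta>A: "\<Theta> * x \<in> range to_fract" "\<Theta> * w \<in> range to_fract"
    using nominal by (simp_all add: x_def w_def)
  have "\<Theta> * (1 / (1 - p' * c)) \<in> range to_fract \<and> \<Theta> * (p' / (1 - p' * c)) \<in> range to_fract"
    if p': "p' \<in> stab c" for p'
  proof -
    define x' w' n where "x' = 1 / (1 - p' * c)" and "w' = p' / (1 - p' * c)" and "n = w' - w"
    have nz': "1 - p' * c \<noteq> 0"
      using p' by (simp add: stab_def mult.commute)
    have "x' - c * w' = 1"
      using nz' by (simp add: x'_def w'_def field_simps)
    then have x': "x' = x + n * c"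
      using bezout by (simp add: n_def algebra_simps)
    have A': "x' \<in> range to_fract" "w' \<in> range to_fract" "c * x' \<in> range to_fract"
      using p' by (simp_all add: stab_def x'_def w'_def mult.commute)
    have n: "n \<in> range to_fract"
      using A(2) A'(2) by (simp add: n_def range_to_fract_diff)
    have nc: "n * c \<in> range to_fract"
      using range_to_fract_diff[OF A'(1) A(1)] by (simp add: x')
    have nc2: "n * c\<^sup>2 \<in> range to_fract"
      using range_to_fract_diff[OF A'(3) A(3)] by (simp add: x' power2_eq_square algebra_simps)
    define r s where "r = n * x - 3 * (n * c) * w" and "s = n * c\<^sup>2 * (3 * x - c * w)"
    have rs: "r \<in> range to_fract" "s \<in> range to_fract"
      unfolding r_def s_def using A cw n nc nc2 by - (assumption | rule range_to_fract_closed)+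
    have n_eq: "n = x\<^sup>2 * r + w\<^sup>2 * s"
      unfolding r_def s_def by (rule cubed_bezout_expansion[OF bezout])
    have "w' = w + (x\<^sup>2 * r + w\<^sup>2 * s)" "x' = x + (x\<^sup>2 * r + w\<^sup>2 * s) * c"
      unfolding n_eq[symmetric] using x' by (simp_all add: n_def)
    then have "\<Theta> * w' = \<Theta> * w + (\<Theta> * x) * x * r + (\<Theta> * w) * w * s"
      and "\<Theta> * x' = \<Theta> * x + (\<Theta> * x) * (c * x) * r + (\<Theta> * w) * (c * w) * s"
      by (simp_all add: power2_eq_square algebra_simps)
    moreover have "\<Theta> * w + (\<Theta> * x) * x * r + (\<Theta> * w) * w * s \<in> range to_fract"
      and "\<Theta> * x + (\<Theta> * x) * (c * x) * r + (\<Theta> * w) * (c * w) * s \<in> range to_fract"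
      using A cw \<Theta>A rs by - (assumption | rule range_to_fract_closed)+
    ultimately show ?thesis
      by (simp add: x'_def w'_def)
  qed
  then show "robustly_regulating p \<Theta> c"
    using nominal by (simp add: robustly_regulating_def)
qed

text \<open>Weak coprimality is used with \<open>k = y / \<theta>\<close>, for which \<open>k \<gamma> = \<Theta> y\<close> and \<open>k \<theta> = y\<close>.\<close>
lemma weakly_coprime_factorization_mult_mem_iff:
  assumes wc: "weakly_coprime_factorization \<Theta> \<gamma> \<theta>" and y: "y \<in> range to_fract"
  shows "\<Theta> * y \<in> range to_fract \<longleftrightarrow> y / to_fract \<theta> \<in> range to_fract"
proof -
  have "\<theta> \<noteq> 0" and \<Theta>: "\<Theta> = to_fract \<gamma> / to_fract \<theta>"
    using wc unfolding weakly_coprime_factorization_def by simp_all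
  have \<gamma>: "y / to_fract \<theta> * to_fract \<gamma> = \<Theta> * y"
    by (simp add: \<Theta>)
  have \<theta>: "y / to_fract \<theta> * to_fract \<theta> = y"
    using \<open>\<theta> \<noteq> 0\<close> by simp
  show ?thesis
  proof
    assume "\<Theta> * y \<in> range to_fract"
    then have "y / to_fract \<theta> * to_fract \<gamma> \<in> range to_fract \<and>
        y / to_fract \<theta> * to_fract \<theta> \<in> range to_fract"
      unfolding \<gamma> \<theta> using y by (rule conjI)
    with wc show "y / to_fract \<theta> \<in> range to_fract"
      unfolding weakly_coprime_factorization_def by blast
  next
    assume "y / to_fract \<theta> \<in> range to_fract"
    from range_to_fract_mult[OF this rangeI[of to_fract \<gamma>]]
    show "\<Theta> * y \<in> range to_fract"
      unfolding \<gamma> .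
  qed
qed

text \<open>
  The conditions that \<open>1 / (1 - p c)\<close> and \<open>p / (1 - p c)\<close> themselves lie in \<open>A\<close> are
  absorbed by the divisibility by \<open>\<theta>\<close>.
\<close>
lemma robustly_regulating_iff_divisible:
  assumes wc: "weakly_coprime_factorization \<Theta> \<gamma> \<theta>"
  shows "robustly_regulating p \<Theta> c \<longleftrightarrow>
     1 - p * c \<noteq> 0 \<and> c / (1 - p * c) \<in> range to_fract \<and>
     1 / (1 - p * c) / to_fract \<theta> \<in> range to_fract \<and>
     p / (1 - p * c) / to_fract \<theta> \<in> range to_fract"
proof -
  have "\<theta> \<noteq> 0"
    using wc by (simp add: weakly_coprime_factorization_def)
  then have "y \<in> range to_fract" if "y / to_fract \<theta> \<in> range to_fract" for y
    using range_to_fract_mult[OF that rangeI[of to_fract \<theta>]] by simp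
  then have "y \<in> range to_fract \<and> \<Theta> * y \<in> range to_fract \<longleftrightarrow>
      y / to_fract \<theta> \<in> range to_fract" for y
    using weakly_coprime_factorization_mult_mem_iff[OF wc, of y] by blast
  from this[of "1 / (1 - p * c)"] this[of "p / (1 - p * c)"] show ?thesis
    unfolding robustly_regulating_iff_nominal stab_def mem_Collect_eq by argo
qed

theorem corollary4p8:
  fixes p \<Theta> c a b :: "'a::idom fract" and \<gamma> \<theta> :: 'a
  assumes "robustly_regulating p \<Theta> c"
    and "weakly_coprime_factorization \<Theta> \<gamma> \<theta>"
    and "a = inverse (1 - p * c)"
    and "b = to_fract \<theta> * c * inverse (1 - p * c)"
  shows "{c'. robustly_regulating p \<Theta> c'} =
    {(b + to_fract q1 * a^2 + to_fract q2 * b^2) /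
     (to_fract \<theta> * a + to_fract q1 * a^2 * p + to_fract q2 * b^2 * p) | q1 q2.
       to_fract \<theta> * a + to_fract q1 * a^2 * p + to_fract q2 * b^2 * p \<noteq> 0}"
proof -
  define t where "t = to_fract \<theta>"
  define v where "v = c / (1 - p * c)"
  have t: "t \<noteq> 0" "t \<in> range to_fract"
    using assms(2) by (auto simp: t_def weakly_coprime_factorization_def)
  note char = robustly_regulating_iff_divisible[OF assms(2), folded t_def]
  have nz: "1 - p * c \<noteq> 0"
    and v: "v \<in> range to_fract"
    and at: "a / t \<in> range to_fract"
    and pat: "p * (a / t) \<in> range to_fract"
    using assms(1) unfolding char by (simp_all add: v_def assms(3) field_simps)
  have b: "b = t * v"
    by (simp add: assms(4) v_def t_def divide_inverse)
  have bezout: "a - p * v = 1"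
    using nz by (simp add: assms(3) v_def field_simps)
  have a: "a \<in> range to_fract"
    using range_to_fract_mult[OF at t(2)] t(1) by simp
  have pv: "p * v \<in> range to_fract"
    using range_to_fract_diff[OF a range_to_fract_one] bezout by (simp add: algebra_simps)
  have "c' \<in> {(b + to_fract q1 * a^2 + to_fract q2 * b^2) /
      (t * a + to_fract q1 * a^2 * p + to_fract q2 * b^2 * p) | q1 q2.
      t * a + to_fract q1 * a^2 * p + to_fract q2 * b^2 * p \<noteq> 0}"
    if "robustly_regulating p \<Theta> c'" for c'
  proof -
    define x' v' m where "x' = 1 / (1 - p * c')" and "v' = c' / (1 - p * c')" and "m = v' - v"
    have nz': "1 - p * c' \<noteq> 0"
      and v': "v' \<in> range to_fract"
      and xt': "x' / t \<in> range to_fract"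
      and pxt': "p * (x' / t) \<in> range to_fract"
      using that unfolding char by (simp_all add: v'_def x'_def)
    have "x' - p * v' = 1"
      using nz' by (simp add: x'_def v'_def field_simps)
    then have x': "x' = a + p * m"
      using bezout by (simp add: m_def algebra_simps)
    have x'nz: "x' \<noteq> 0"
      using nz' by (simp add: x'_def)
    have m: "m \<in> range to_fract"
      using v v' by (simp add: m_def range_to_fract_diff)
    have pmt: "m * p / t \<in> range to_fract"
      using range_to_fract_diff[OF xt' at] by (simp add: x' add_divide_distrib algebra_simps)
    have ppmt: "m * p\<^sup>2 / t \<in> range to_fract"
      using range_to_fract_diff[OF pxt' pat]
      by (simp add: x' power2_eq_square add_divide_distrib algebra_simps)
    \<comment> \<open>The coefficients of the expansion of \<open>t * m\<close>; the division by \<open>t\<close> in \<open>s\<close> comes from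
      replacing \<open>v\<^sup>2\<close> with \<open>b\<^sup>2 = t\<^sup>2 * v\<^sup>2\<close>.\<close>
    define r s where "r = t * (m * a - 3 * (t * (m * p / t)) * v)"
      and "s = m * p\<^sup>2 / t * (3 * a - p * v)"
    have "r \<in> range to_fract" "s \<in> range to_fract"
      unfolding r_def s_def using a v pv m pmt ppmt t(2)
      by - (assumption | rule range_to_fract_closed)+
    then obtain q1 q2 where q: "r = to_fract q1" "s = to_fract q2"
      by blast
    have "t * m = t * (a\<^sup>2 * (m * a - 3 * (m * p) * v) + v\<^sup>2 * (m * p\<^sup>2 * (3 * a - p * v)))"
      using cubed_bezout_expansion[OF bezout, of m] by (rule arg_cong)
    also have "\<dots> = r * a\<^sup>2 + s * b\<^sup>2"
      using t(1) by (simp add: r_def s_def b power2_eq_square field_simps)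
    finally have tm: "r * a\<^sup>2 + s * b\<^sup>2 = t * m" ..
    have num: "b + r * a\<^sup>2 + s * b\<^sup>2 = t * v'"
      using tm by (simp add: b m_def algebra_simps)
    have "r * a\<^sup>2 * p + s * b\<^sup>2 * p = t * m * p"
      using tm by (simp flip: distrib_right)
    then have den: "t * a + r * a\<^sup>2 * p + s * b\<^sup>2 * p = t * x'"
      by (simp add: x' algebra_simps)
    have "c' = t * v' / (t * x')"
      using t(1) nz' by (simp add: v'_def x'_def)
    moreover have "t * x' \<noteq> 0"
      using t(1) x'nz by simp
    ultimately show ?thesis
      using num den unfolding q by (intro CollectI exI[of _ q1] exI[of _ q2]) simp
  qed
  moreover have "robustly_regulating p \<Theta> ((b + to_fract q1 * a^2 + to_fract q2 * b^2) /
      (t * a + to_fract q1 * a^2 * p + to_fract q2 * b^2 * p))"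
    if "t * a + to_fract q1 * a^2 * p + to_fract q2 * b^2 * p \<noteq> 0" for q1 q2
  proof -
    define r s where "r = to_fract q1" and "s = to_fract q2"
    \<comment> \<open>This is \<open>(r * a\<^sup>2 + s * b\<^sup>2) / t\<close>, written as a sum of products of elements of \<open>A\<close>.\<close>
    define m where "m = r * (a / t) * a + s * t * v * v"
    define x' v' c' where "x' = a + p * m" and "v' = v + m" and "c' = v' / x'"
    have rs: "r \<in> range to_fract" "s \<in> range to_fract"
      by (simp_all add: r_def s_def)
    have num: "b + r * a\<^sup>2 + s * b\<^sup>2 = t * v'"
      using t(1) by (simp add: b v'_def m_def power2_eq_square field_simps)
    have den: "t * a + r * a\<^sup>2 * p + s * b\<^sup>2 * p = t * x'"
      using t(1) by (simp add: b x'_def m_def power2_eq_square field_simps)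
    have x'nz: "x' \<noteq> 0"
      using that den by (auto simp: r_def s_def)
    have "x' - p * v' = 1"
      using bezout by (simp add: x'_def v'_def algebra_simps)
    then have inv: "1 - p * c' = 1 / x'"
      using x'nz by (simp add: c'_def field_simps)
    have "v' \<in> range to_fract"
      unfolding v'_def m_def using rs a at v t(2) by - (assumption | rule range_to_fract_closed)+
    moreover have "a / t + r * (a / t) * (p * (a / t)) + s * v * (p * v) \<in> range to_fract"
      using rs a at pat v pv t(2) by - (assumption | rule range_to_fract_closed)+
    moreover have "x' / t = a / t + r * (a / t) * (p * (a / t)) + s * v * (p * v)"
      using t(1) by (simp add: x'_def m_def field_simps)
    moreover have "p * (a / t) + r * (p * (a / t)) * (p * (a / t)) + s * (p * v) * (p * v)
        \<in> range to_fract"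
      using rs a at pat v pv t(2) by - (assumption | rule range_to_fract_closed)+
    moreover have "p * x' / t =
        p * (a / t) + r * (p * (a / t)) * (p * (a / t)) + s * (p * v) * (p * v)"
      using t(1) by (simp add: x'_def m_def field_simps)
    ultimately have "robustly_regulating p \<Theta> c'"
      unfolding char inv using x'nz by (simp add: c'_def)
    moreover have "c' = t * v' / (t * x')"
      using t(1) by (simp add: c'_def)
    ultimately show ?thesis
      using num den by (simp add: r_def s_def)
  qed
  ultimately show ?thesis
    unfolding t_def by blast
qed

end
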